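(* Let $(X,d)$ be an unbounded metric space, let $p\in X$, and let $n\ge 2$ be an integer. Then the inequality $|\Omega_{\infty,\tilde r}^{X}|\le n$ holds for every pretangent space $\Omega_{\infty,\tilde r}^{X}$ to $(X,d)$ at infinity (for every scaling sequence $\tilde r$ and every maximal self-stable set) if and only if $$\lim_{x_1,\ldots,x_n\to\infty}F_n(x_1,\ldots,x_n)=0,$$ where $F_n:X^n\to\mathbb R$ is defined by $F_n(p,\ldots,p)=0$ and, for $(x_1,\ldots,x_n)\neq(p,\ldots,p)$, $$F_n(x_1,\ldots,x_n)=\frac{\min_{1\le k\le n}d(x_k,p)\,\prod_{1\le k<l\le n}d(x_k,x_l)}{\left(\max_{1\le k\le n}d(x_k,p)\right)^{\frac{n(n-1)}{2}+1}}.$$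
   Context: Here $x_1,\ldots,x_n\to\infty$ means $d(x_k,p)\to\infty$ for every $k=1,\ldots,n$; $|\cdot|$ denotes cardinality. A scaling sequence is a sequence $\tilde r=(r_n)_{n\in\mathbb N}$ of positive real numbers with $\lim_{n\to\infty}r_n=\infty$. $Seq(X,\tilde r)$ is the set of all sequences $\tilde x=(x_n)_{n\in\mathbb N}$ in $X$ such that $\lim_{n\to\infty} d(x_n,p)=\infty$ and the limit $\lim_{n\to\infty} d(x_n,p)/r_n$ exists and is finite (this does not depend on $p$). Two sequences $\tilde x,\tilde y$ in $X$ are mutually stable (with respect to $\tilde r$) if the limit $\tilde d_{\tilde r}(\tilde x,\tilde y):=\lim_{n\to\infty}d(x_n,y_n)/r_n$ exists and is finite. A set $F\subseteq Seq(X,\tilde r)$ is self-stable if any two of its elements are mutually stable; it is maximal self-stable if it is self-stable and for every $\tilde y\in Seq(X,\tilde r)$ either $\tilde y\in F$ or there is $\tilde x\in F$ such that $\tilde x$ and $\tilde y$ are not mutually stable. Maximal self-stable sets are denoted $\tilde X_{\infty,\tilde r}$. The pretangent space $(\Omega_{\infty,\tilde r}^X,\rho)$ to $(X,d)$ at infinity with respect to $\tilde r$ corresponding to $\tilde X_{\infty,\tilde r}$ is the metric identification of the pseudometric space $(\tilde X_{\infty,\tilde r},\tilde d_{\tilde r})$: points are the classes of the relation $\tilde x\equiv\tilde y\Leftrightarrow\tilde d_{\tilde r}(\tilde x,\tilde y)=0$ on $\tilde X_{\infty,\tilde r}$, and $\rho(\alpha,\beta)=\tilde d_{\tilde r}(\tilde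 x,\tilde y)$ for $\tilde x\in\alpha$, $\tilde y\in\beta$. *)

theory Defs
  imports "HOL-Analysis.Analysis"
begin

definition scaling_sequence :: "(nat \<Rightarrow> real) \<Rightarrow> bool" where
  "scaling_sequence r \<longleftrightarrow> (\<forall>n. r n > 0) \<and> filterlim r at_top sequentially"

text \<open>The base point \<open>p\<close> is an explicit argument; the set does not depend on it
  (lemma \<open>Seq_base_point\<close> below).\<close>

definition Seq :: "'a::metric_space \<Rightarrow> (nat \<Rightarrow> real) \<Rightarrow> (nat \<Rightarrow> 'a) set" where
  "Seq p r = {x. filterlim (\<lambda>n. dist (x n) p) at_top sequentially
               \<and> convergent (\<lambda>n. dist (x n) p / r n)}"

definition mutually_stable ::
    "(nat \<Rightarrow> real) \<Rightarrow> (nat \<Rightarrow> 'a::metric_space) \<Rightarrow> (nat \<Rightarrow> 'a) \<Rightarrow> bool" where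
  "mutually_stable r x y \<longleftrightarrow> convergent (\<lambda>n. dist (x n) (y n) / r n)"

definition scaled_dist ::
    "(nat \<Rightarrow> real) \<Rightarrow> (nat \<Rightarrow> 'a::metric_space) \<Rightarrow> (nat \<Rightarrow> 'a) \<Rightarrow> real" where
  "scaled_dist r x y = lim (\<lambda>n. dist (x n) (y n) / r n)"

definition self_stable ::
    "'a::metric_space \<Rightarrow> (nat \<Rightarrow> real) \<Rightarrow> (nat \<Rightarrow> 'a) set \<Rightarrow> bool" where
  "self_stable p r F \<longleftrightarrow> F \<subseteq> Seq p r \<and> (\<forall>x\<in>F. \<forall>y\<in>F. mutually_stable r x y)"

definition maximal_self_stable ::
    "'a::metric_space \<Rightarrow> (nat \<Rightarrow> real) \<Rightarrow> (nat \<Rightarrow> 'a) set \<Rightarrow> bool" where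
  "maximal_self_stable p r F \<longleftrightarrow>
     self_stable p r F \<and> (\<forall>y\<in>Seq p r. y \<in> F \<or> (\<exists>x\<in>F. \<not> mutually_stable r x y))"

text \<open>The pretangent space corresponding to \<open>F\<close> is the metric space with carrier
  \<open>pretangent_space r F\<close> and metric \<open>pretangent_dist r F\<close>
  (lemma \<open>Metric_space_pretangent\<close> below).\<close>

definition pretangent_space ::
    "(nat \<Rightarrow> real) \<Rightarrow> (nat \<Rightarrow> 'a::metric_space) set \<Rightarrow> (nat \<Rightarrow> 'a) set set" where
  "pretangent_space r F = F // {(x, y). x \<in> F \<and> y \<in> F \<and> scaled_dist r x y = 0}"

text \<open>The value \<open>0\<close> outside the carrier is a junk value: the locale \<open>Metric_space\<close> demands
  nonnegativity and symmetry there too.\<close>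

definition pretangent_dist :: "(nat \<Rightarrow> real) \<Rightarrow> (nat \<Rightarrow> 'a::metric_space) set \<Rightarrow>
    (nat \<Rightarrow> 'a) set \<Rightarrow> (nat \<Rightarrow> 'a) set \<Rightarrow> real" where
  "pretangent_dist r F \<alpha> \<beta> =
     (if \<alpha> \<in> pretangent_space r F \<and> \<beta> \<in> pretangent_space r F
      then scaled_dist r (SOME x. x \<in> \<alpha>) (SOME y. y \<in> \<beta>) else 0)"

text \<open>An element \<open>(x\<^sub>1, \<dots>, x\<^sub>n)\<close> of \<open>X\<^sup>n\<close> is represented by a function on \<open>nat\<close> of which
  only the values at \<open>1, \<dots>, n\<close> are used.\<close>

definition F_fun :: "nat \<Rightarrow> 'a::metric_space \<Rightarrow> (nat \<Rightarrow> 'a) \<Rightarrow> real" where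
  "F_fun n p x =
     (if \<forall>k\<in>{1..n}. x k = p then 0
      else (MIN k\<in>{1..n}. dist (x k) p)
             * (\<Prod>(k, l)\<in>{(k, l). 1 \<le> k \<and> k < l \<and> l \<le> n}. dist (x k) (x l))
           / (MAX k\<in>{1..n}. dist (x k) p) ^ (n * (n - 1) div 2 + 1))"

text \<open>The filter of \<open>x\<^sub>1, \<dots>, x\<^sub>n \<rightarrow> \<infinity>\<close>, i.e. \<open>d(x\<^sub>k, p) \<rightarrow> \<infinity>\<close> for every
  \<open>k\<close>; see \<open>eventually_tuples_to_infinity\<close> below.\<close>

definition tuples_to_infinity :: "nat \<Rightarrow> 'a::metric_space \<Rightarrow> (nat \<Rightarrow> 'a) filter" where
  "tuples_to_infinity n p = (INF k\<in>{1..n}. filtercomap (\<lambda>x. dist (x k) p) at_top)"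

lemma eventually_tuples_to_infinity:
  "eventually P (tuples_to_infinity n p) \<longleftrightarrow>
     (\<exists>R. \<forall>x. (\<forall>k\<in>{1..n}. dist (x k) p \<ge> R) \<longrightarrow> P x)" (is "?L \<longleftrightarrow> ?R")
proof
  assume ?L
  then obtain Q where Q: "\<And>k. k \<in> {1..n} \<Longrightarrow>
        eventually (Q k) (filtercomap (\<lambda>x::nat \<Rightarrow> 'a. dist (x k) p) at_top)"
      "\<And>x. (\<forall>k\<in>{1..n}. Q k x) \<Longrightarrow> P x"
    unfolding tuples_to_infinity_def by (subst (asm) eventually_INF_finite) (simp, blast)
  have "\<forall>k\<in>{1..n}. \<exists>R. \<forall>x. dist (x k) p \<ge> R \<longrightarrow> Q k x"
    using Q(1) unfolding eventually_filtercomap_at_top_linorder by blast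
  then obtain R where R: "\<And>k x. k \<in> {1..n} \<Longrightarrow> dist (x k) p \<ge> R k \<Longrightarrow> Q k x"
    by metis
  have "P x" if "\<forall>k\<in>{1..n}. dist (x k) p \<ge> Max (insert 0 (R ` {1..n}))" for x
    using that by (intro Q(2) ballI R) auto
  then show ?R by blast
next
  assume ?R
  then obtain R where R: "\<And>x. (\<forall>k\<in>{1..n}. dist (x k) p \<ge> R) \<Longrightarrow> P x" by blast
  have "eventually (\<lambda>x. dist (x k) p \<ge> R) (tuples_to_infinity n p)" if "k \<in> {1..n}" for k
  proof (rule filter_leD)
    show "tuples_to_infinity n p \<le> filtercomap (\<lambda>x. dist (x k) p) at_top"
      unfolding tuples_to_infinity_def using that by (rule INF_lower)
  qed (intro eventually_filtercomapI eventually_ge_at_top)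
  then have "eventually (\<lambda>x. \<forall>k\<in>{1..n}. dist (x k) p \<ge> R) (tuples_to_infinity n p)"
    by (simp add: eventually_ball_finite)
  then show ?L by (rule eventually_mono) (use R in auto)
qed

lemma Seq_base_point:
  assumes "scaling_sequence r"
  shows "Seq p r = Seq q r"
proof -
  have "Seq p r \<subseteq> Seq q r" for p q :: 'a
  proof
    fix x assume "x \<in> Seq p r"
    then obtain L where inf: "filterlim (\<lambda>n. dist (x n) p) at_top sequentially"
      and L: "(\<lambda>n. dist (x n) p / r n) \<longlonglongrightarrow> L"
      by (auto simp: Seq_def convergent_def)
    have r: "\<And>n. r n > 0" "filterlim r at_top sequentially"
      using assms by (auto simp: scaling_sequence_def)
    have "filterlim (\<lambda>n. - dist p q + dist (x n) p) at_top sequentially"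
      by (rule filterlim_tendsto_add_at_top[OF tendsto_const inf])
    then have 1: "filterlim (\<lambda>n. dist (x n) q) at_top sequentially"
    proof (rule filterlim_at_top_mono, intro always_eventually allI)
      show "- dist p q + dist (x n) p \<le> dist (x n) q" for n
        using dist_triangle[of "x n" p q] by (simp add: dist_commute)
    qed
    have "(\<lambda>n. dist p q / r n) \<longlonglongrightarrow> 0"
      by (intro tendsto_divide_0[OF tendsto_const] filterlim_at_top_imp_at_infinity r)
    then have "(\<lambda>n. dist (x n) q / r n - dist (x n) p / r n) \<longlonglongrightarrow> 0"
    proof (rule Lim_null_comparison[rotated], intro always_eventually allI)
      fix n
      have "\<bar>dist (x n) q - dist (x n) p\<bar> \<le> dist p q"
        using dist_triangle[of "x n" p q] dist_triangle[of "x n" q p] by (simp add: dist_commute)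
      then show "norm (dist (x n) q / r n - dist (x n) p / r n) \<le> dist p q / r n"
        using r(1)[of n] by (simp add: divide_right_mono flip: diff_divide_distrib)
    qed
    from tendsto_add[OF this L] have "convergent (\<lambda>n. dist (x n) q / r n)"
      by (auto simp: convergent_def)
    with 1 show "x \<in> Seq q r" by (simp add: Seq_def)
  qed
  then show ?thesis by blast
qed

lemma Metric_space_pretangent:
  assumes "scaling_sequence r" and "self_stable p r F"
  shows "Metric_space (pretangent_space r F) (pretangent_dist r F)"
    and "\<lbrakk>\<alpha> \<in> pretangent_space r F; \<beta> \<in> pretangent_space r F; x \<in> \<alpha>; y \<in> \<beta>\<rbrakk>
           \<Longrightarrow> pretangent_dist r F \<alpha> \<beta> = scaled_dist r x y"
proof -
  let ?E = "{(x, y). x \<in> F \<and> y \<in> F \<and> scaled_dist r x y = 0}"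
  have r: "r n > 0" for n using assms(1) by (simp add: scaling_sequence_def)
  have lim: "(\<lambda>n. dist (x n) (y n) / r n) \<longlonglongrightarrow> scaled_dist r x y" if "x \<in> F" "y \<in> F" for x y
    using assms(2) that
    by (simp add: self_stable_def mutually_stable_def scaled_dist_def convergent_LIMSEQ_iff)
  have nonneg: "scaled_dist r x y \<ge> 0" if "x \<in> F" "y \<in> F" for x y
    by (rule LIMSEQ_le_const[OF lim[OF that]]) (use r in \<open>auto intro!: exI[of _ 0] simp: less_imp_le\<close>)
  have refl: "scaled_dist r x x = 0" for x :: "nat \<Rightarrow> 'a" by (simp add: scaled_dist_def)
  have comm: "scaled_dist r x y = scaled_dist r y x" for x y :: "nat \<Rightarrow> 'a"
    by (simp add: scaled_dist_def dist_commute)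
  have tri: "scaled_dist r x z \<le> scaled_dist r x y + scaled_dist r y z"
    if "x \<in> F" "y \<in> F" "z \<in> F" for x y z
  proof (rule LIMSEQ_le[OF lim[OF that(1,3)] tendsto_add[OF lim[OF that(1,2)] lim[OF that(2,3)]]],
      intro exI allI impI)
    show "dist (x n) (z n) / r n \<le> dist (x n) (y n) / r n + dist (y n) (z n) / r n" for n
      using r[of n] by (simp add: divide_right_mono dist_triangle flip: add_divide_distrib)
  qed
  have equiv: "equiv F ?E"
  proof (rule equivI)
    show "trans ?E"
    proof (rule transI)
      fix x y z assume "(x, y) \<in> ?E" "(y, z) \<in> ?E"
      then show "(x, z) \<in> ?E" using tri[of x y z] nonneg[of x z] by auto
    qed
  qed (auto simp: refl_on_def sym_def refl comm)
  have sub: "x \<in> F" if "\<alpha> \<in> pretangent_space r F" "x \<in> \<alpha>" for \<alpha> x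
    using that by (auto simp: pretangent_space_def quotient_def)
  have zero: "scaled_dist r x y = 0" if "\<alpha> \<in> pretangent_space r F" "x \<in> \<alpha>" "y \<in> \<alpha>" for \<alpha> x y
    using quotient_eq_iff[OF equiv that(1)[unfolded pretangent_space_def]
        that(1)[unfolded pretangent_space_def] that(2,3)] by simp
  have ne: "\<exists>x. x \<in> \<alpha>" if "\<alpha> \<in> pretangent_space r F" for \<alpha>
    using in_quotient_imp_non_empty[OF equiv that[unfolded pretangent_space_def]] by blast
  have wd: "pretangent_dist r F \<alpha> \<beta> = scaled_dist r x y"
    if "\<alpha> \<in> pretangent_space r F" "\<beta> \<in> pretangent_space r F" "x \<in> \<alpha>" "y \<in> \<beta>" for \<alpha> \<beta> x y
  proof -
    define a b where "a = (SOME x. x \<in> \<alpha>)" and "b = (SOME y. y \<in> \<beta>)"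
    have ab: "a \<in> \<alpha>" "b \<in> \<beta>"
      using that by (auto simp: a_def b_def some_in_eq)
    have F: "a \<in> F" "b \<in> F" "x \<in> F" "y \<in> F"
      using sub[OF that(1)] sub[OF that(2)] that(3,4) ab by simp_all
    have "scaled_dist r a x = 0" "scaled_dist r b y = 0"
      by (rule zero[OF that(1) ab(1) that(3)], rule zero[OF that(2) ab(2) that(4)])
    then have "scaled_dist r a b = scaled_dist r x y"
      using tri[of a x b] tri[of x y b] tri[of x a y] tri[of a b y] F comm[of x a] comm[of b y]
      by linarith
    then show ?thesis using that by (simp add: pretangent_dist_def a_def b_def)
  qed
  show "\<lbrakk>\<alpha> \<in> pretangent_space r F; \<beta> \<in> pretangent_space r F; x \<in> \<alpha>; y \<in> \<beta>\<rbrakk>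
           \<Longrightarrow> pretangent_dist r F \<alpha> \<beta> = scaled_dist r x y"
    by (rule wd)
  show "Metric_space (pretangent_space r F) (pretangent_dist r F)"
  proof
    fix \<alpha> \<beta>
    show "0 \<le> pretangent_dist r F \<alpha> \<beta>"
    proof (cases "\<alpha> \<in> pretangent_space r F \<and> \<beta> \<in> pretangent_space r F")
      case True
      then obtain x y where "x \<in> \<alpha>" "y \<in> \<beta>" using ne by blast
      moreover from this have "x \<in> F" "y \<in> F" using True sub by blast+
      ultimately show ?thesis using True nonneg[of x y] by (simp add: wd[of _ _ x y])
    qed (auto simp: pretangent_dist_def)
    show "pretangent_dist r F \<alpha> \<beta> = pretangent_dist r F \<beta> \<alpha>"
      by (simp add: pretangent_dist_def comm)
  next
    fix \<alpha> \<beta> assume *: "\<alpha> \<in> pretangent_space r F" "\<beta> \<in> pretangent_space r F"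
    obtain x y where xy: "x \<in> \<alpha>" "y \<in> \<beta>" using ne[OF *(1)] ne[OF *(2)] by blast
    have "scaled_dist r x y = 0 \<longleftrightarrow> \<alpha> = \<beta>"
      using quotient_eq_iff[OF equiv *[unfolded pretangent_space_def] xy] sub[OF *(1) xy(1)] sub[OF *(2) xy(2)]
      by auto
    then show "pretangent_dist r F \<alpha> \<beta> = 0 \<longleftrightarrow> \<alpha> = \<beta>" by (simp add: wd[OF * xy])
  next
    fix \<alpha> \<beta> \<gamma>
    assume *: "\<alpha> \<in> pretangent_space r F" "\<beta> \<in> pretangent_space r F" "\<gamma> \<in> pretangent_space r F"
    obtain x y z where xyz: "x \<in> \<alpha>" "y \<in> \<beta>" "z \<in> \<gamma>"
      using ne[OF *(1)] ne[OF *(2)] ne[OF *(3)] by blast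
    have "x \<in> F" "y \<in> F" "z \<in> F" using sub * xyz by blast+
    then show "pretangent_dist r F \<alpha> \<gamma> \<le> pretangent_dist r F \<alpha> \<beta> + pretangent_dist r F \<beta> \<gamma>"
      by (simp add: wd[OF *(1,3) xyz(1,3)] wd[OF *(1,2) xyz(1,2)] wd[OF *(2,3) xyz(2,3)] tri)
  qed
qed

end

(* Let z be a sequence in X tending to infinity more slowly than r.  It is mutually stable with
   every sequence x in Seq(X, r), at distance lim d(x_m, p) / r_m, so its class belongs to every
   pretangent space.  Hence a pretangent space has more than n points iff it contains n points at
   positive distance from each other and from the class of z.  As F_n is homogeneous of degree 0,
   for representatives of such points F_n stays away from 0.  Conversely, let F_n be at least eps
   on a sequence of tuples tending to infinity, and normalize by r_m = max_k d(x_k, p): all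
   normalized distances lie between a positive constant and 2, so on a subsequence they converge
   to positive limits, and Zorn's lemma gives a pretangent space with n + 1 points. *)
theory Submission
  imports Defs
begin

section \<open>Pairs and the function \<open>F\<^sub>n\<close>\<close>

text \<open>The index set of the product in \<open>F_fun\<close>; its cardinality is the exponent of
  the maximum there less one.\<close>

definition index_pairs :: "nat \<Rightarrow> (nat \<times> nat) set" where
  "index_pairs n = {(k, l). 1 \<le> k \<and> k < l \<and> l \<le> n}"

lemma finite_index_pairs [simp]: "finite (index_pairs n)"
  by (rule finite_subset[of _ "{1..n} \<times> {1..n}"]) (auto simp: index_pairs_def)

lemma card_index_pairs: "card (index_pairs n) = n * (n - 1) div 2"
proof (induction n)
  case 0
  have "index_pairs 0 = {}" by (auto simp: index_pairs_def)
  then show ?case by simp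
next
  case (Suc n)
  have "index_pairs (Suc n) = index_pairs n \<union> (\<lambda>k. (k, Suc n)) ` {1..n}"
    by (auto simp: index_pairs_def)
  moreover have "index_pairs n \<inter> (\<lambda>k. (k, Suc n)) ` {1..n} = {}"
    by (auto simp: index_pairs_def)
  moreover have "card ((\<lambda>k. (k, Suc n)) ` {1..n}) = n"
    by (subst card_image) (auto simp: inj_on_def)
  ultimately have "card (index_pairs (Suc n)) = n * (n - 1) div 2 + n"
    by (simp add: card_Un_disjoint Suc)
  also have "\<dots> = (n * (n - 1) + n * 2) div 2"
    by simp
  also have "n * (n - 1) + n * 2 = Suc n * (Suc n - 1)"
    by (cases n) (auto simp: algebra_simps)
  finally show ?case .
qed

text \<open>The exponent in \<open>F_fun\<close> is the number of pairs plus one, so one factor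
  \<open>R\<close> goes to the minimum and one to each pair distance. Positivity of \<open>R\<close>
  excludes the branch where all points equal \<open>p\<close>.\<close>

lemma F_fun_normalized:
  fixes p :: "'a::metric_space"
  assumes "n \<ge> 1" and "(MAX k\<in>{1..n}. dist (x k) p) = R" and "R > 0"
  shows "F_fun n p x = (MIN k\<in>{1..n}. dist (x k) p) / R
           * (\<Prod>(k, l)\<in>index_pairs n. dist (x k) (x l) / R)"
proof -
  have "(\<Prod>(k, l)\<in>index_pairs n. dist (x k) (x l) / R)
      = (\<Prod>(k, l)\<in>index_pairs n. dist (x k) (x l)) / R ^ (n * (n - 1) div 2)"
    by (simp add: case_prod_beta prod_dividef card_index_pairs)
  moreover have ne: "\<not> (\<forall>k\<in>{1..n}. x k = p)"
  proof
    assume *: "\<forall>k\<in>{1..n}. x k = p"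
    have "R \<in> (\<lambda>k. dist (x k) p) ` {1..n}"
      unfolding assms(2)[symmetric] using assms(1) by (intro Max_in) auto
    with * assms(3) show False by auto
  qed
  ultimately show ?thesis
    unfolding F_fun_def assms(2) index_pairs_def[symmetric] if_not_P[OF ne] by simp
qed

text \<open>All normalized factors are bounded, the minimum by 1 and the pair distances by 2
  (triangle inequality through \<open>p\<close>). Keeping one factor and bounding the others shows
  that a lower bound on \<open>F_fun\<close> bounds each normalized distance from below.\<close>

lemma F_fun_upper_bounds:
  fixes p :: "'a::metric_space"
  assumes "n \<ge> 1" and R: "(MAX k\<in>{1..n}. dist (x k) p) = R" "R > 0"
  shows "k \<in> {1..n} \<Longrightarrow> F_fun n p x \<le> 2 ^ card (index_pairs n) * (dist (x k) p / R)"
    and "(k, l) \<in> index_pairs n \<Longrightarrow>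
           F_fun n p x \<le> 2 ^ card (index_pairs n) * (dist (x k) (x l) / R)"
proof -
  let ?m = "MIN k\<in>{1..n}. dist (x k) p"
  define q where "q = (\<lambda>(k, l). dist (x k) (x l) / R)"
  have F: "F_fun n p x = ?m / R * prod q (index_pairs n)"
    using F_fun_normalized[OF assms] by (simp add: q_def)
  have le_R: "dist (x k) p \<le> R" if "k \<in> {1..n}" for k
    unfolding R(1)[symmetric] using that by (intro Max_ge) auto
  have m: "?m \<le> dist (x k) p" if "k \<in> {1..n}" for k
    using that by (intro Min_le) auto
  have m0: "0 \<le> ?m"
    using assms(1) by (subst Min_ge_iff) auto
  have q0: "0 \<le> q e" for e
    using R(2) by (simp add: q_def case_prod_beta)
  have q2: "q e \<le> 2" if E: "e \<in> index_pairs n" for e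
  proof -
    obtain k l where e: "e = (k, l)" "k \<in> {1..n}" "l \<in> {1..n}"
      using E by (cases e) (auto simp: index_pairs_def)
    have "dist (x k) (x l) \<le> 2 * R"
      using dist_triangle2[of "x k" "x l" p] le_R[OF e(2)] le_R[OF e(3)] by linarith
    then show ?thesis using R(2) by (simp add: q_def e field_simps)
  qed
  have prod: "prod q A \<le> 2 ^ card A" if "A \<subseteq> index_pairs n" for A
    using prod_mono[of A q "\<lambda>_. 2"] that q0 q2 by (auto simp: subset_iff)
  have prod0: "0 \<le> prod q A" for A
    by (intro prod_nonneg) (use q0 in auto)
  show "F_fun n p x \<le> 2 ^ card (index_pairs n) * (dist (x k) p / R)" if "k \<in> {1..n}"
  proof -
    have "?m / R * prod q (index_pairs n) \<le> dist (x k) p / R * 2 ^ card (index_pairs n)"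
      by (intro mult_mono divide_right_mono prod prod0 m that) (use R(2) in auto)
    then show ?thesis by (simp add: F mult.commute)
  qed
  show "F_fun n p x \<le> 2 ^ card (index_pairs n) * (dist (x k) (x l) / R)"
    if kl: "(k, l) \<in> index_pairs n"
  proof -
    have "k \<in> {1..n}" using kl by (auto simp: index_pairs_def)
    then have "?m / R \<le> 1"
      using order_trans[OF m le_R] R(2) by (simp del: One_nat_def)
    then have "F_fun n p x \<le> prod q (index_pairs n)"
      unfolding F using m0 R(2) by (intro mult_left_le_one_le prod0) (simp_all del: One_nat_def)
    also have "\<dots> = q (k, l) * prod q (index_pairs n - {(k, l)})"
      using kl by (simp add: prod.remove)
    also have "\<dots> \<le> q (k, l) * 2 ^ card (index_pairs n - {(k, l)})"
      by (intro mult_left_mono prod q0) auto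
    \<comment> \<open>Removing the pair saves one factor 2; the full power is restored so that both
      bounds share one constant.\<close>
    also have "\<dots> \<le> q (k, l) * 2 ^ card (index_pairs n)"
      by (intro mult_left_mono power_increasing card_mono q0) auto
    finally show ?thesis by (simp add: q_def mult.commute)
  qed
qed

text \<open>The maximum \<open>R\<close> is at most \<open>C * r\<close>, so passing from the scale
  \<open>r\<close> to \<open>R\<close> turns the lower bound \<open>c\<close> into
  \<open>c / C\<close>. This applies to the minimum and to every pair, which accounts for the
  exponent.\<close>

lemma F_fun_lower_bound:
  fixes p :: "'a::metric_space"
  assumes "n \<ge> 1" and "r > 0" and "c > 0"
    and base: "\<And>k. k \<in> {1..n} \<Longrightarrow> c \<le> dist (x k) p / r \<and> dist (x k) p / r \<le> C"
    and pair: "\<And>k l. (k, l) \<in> index_pairs n \<Longrightarrow> c \<le> dist (x k) (x l) / r"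
  shows "(c / C) ^ Suc (card (index_pairs n)) \<le> F_fun n p x"
proof -
  define R where "R = (MAX k\<in>{1..n}. dist (x k) p)"
  have "R \<in> (\<lambda>k. dist (x k) p) ` {1..n}"
    unfolding R_def using assms(1) by (intro Max_in) auto
  then have "c * r \<le> R" "R \<le> C * r"
    using base assms(2) by (auto simp: field_simps)
  moreover have "0 < c * r" using assms by simp
  ultimately have R: "0 < R" "R \<le> C * r" by linarith+
  have "C > 0" using R assms(2) by (smt (verit) zero_less_mult_pos2)
  have le: "c / C \<le> d / R" if "c \<le> d / r" for d
  proof -
    have "c * r \<le> d" using that assms(2) by (simp add: field_simps)
    then have "c * r * R \<le> d * (C * r)"
      using R \<open>0 < c * r\<close> by (intro mult_mono) auto
    then have "c * R * r \<le> d * C * r" by (simp only: ac_simps)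
    then have "c * R \<le> d * C" using assms(2) by (rule mult_right_le_imp_le)
    then show ?thesis using R \<open>C > 0\<close> by (simp add: field_simps)
  qed
  have "(MIN k\<in>{1..n}. dist (x k) p) \<in> (\<lambda>k. dist (x k) p) ` {1..n}"
    using assms(1) by (intro Min_in) auto
  then have "c / C \<le> (MIN k\<in>{1..n}. dist (x k) p) / R"
    using le base by auto
  moreover have "(c / C) ^ card (index_pairs n)
      \<le> (\<Prod>(k, l)\<in>index_pairs n. dist (x k) (x l) / R)"
    unfolding prod_constant[symmetric] case_prod_beta
    by (intro prod_mono) (use le pair \<open>C > 0\<close> assms(3) in auto)
  moreover have "0 \<le> c / C" using \<open>C > 0\<close> assms(3) by simp
  ultimately show ?thesis
    unfolding F_fun_normalized[OF assms(1) R_def[symmetric] R(1)] power_Suc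
    by (intro mult_mono) (auto simp del: One_nat_def intro: order_trans[OF \<open>0 \<le> c / C\<close>])
qed

section \<open>Finite families of real sequences\<close>

text \<open>Bolzano-Weierstrass is applied to one index after another; convergence already obtained
  survives passage to a further subsequence.\<close>

lemma finite_family_convergent_subsequence:
  fixes f :: "'i \<Rightarrow> nat \<Rightarrow> real"
  assumes "finite I" and "\<And>i. i \<in> I \<Longrightarrow> bounded (range (f i))"
  shows "\<exists>\<sigma>. strict_mono \<sigma> \<and> (\<forall>i\<in>I. convergent (f i \<circ> \<sigma>))"
  using assms
proof (induction I rule: finite_induct)
  case empty
  show ?case using strict_mono_id by blast
next
  case (insert j I)
  then obtain \<sigma> where \<sigma>: "strict_mono \<sigma>" "\<forall>i\<in>I. convergent (f i \<circ> \<sigma>)"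
    by blast
  have "bounded (range (f j \<circ> \<sigma>))"
    using insert.prems[of j] by (rule bounded_subset) auto
  then obtain l \<tau> where \<tau>: "strict_mono \<tau>" "(f j \<circ> \<sigma> \<circ> \<tau>) \<longlonglongrightarrow> l"
    using bounded_imp_convergent_subsequence by blast
  show ?case
  proof (intro exI[of _ "\<sigma> \<circ> \<tau>"] conjI ballI)
    show "strict_mono (\<sigma> \<circ> \<tau>)" using \<sigma>(1) \<tau>(1) by (rule strict_mono_o)
    fix i assume "i \<in> insert j I"
    then show "convergent (f i \<circ> (\<sigma> \<circ> \<tau>))"
      using \<tau> \<sigma>(2) convergent_subseq_convergent[OF _ \<tau>(1)]
      by (auto simp: convergent_def o_assoc)
  qed
qed

lemma finite_family_eventually_bounds:
  fixes f :: "'i \<Rightarrow> 'b \<Rightarrow> real"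
  assumes "finite I" and lim: "\<And>i. i \<in> I \<Longrightarrow> (f i \<longlongrightarrow> L i) G" and "\<And>i. i \<in> I \<Longrightarrow> L i > 0"
  obtains c C where "c > 0" and "eventually (\<lambda>m. \<forall>i\<in>I. c \<le> f i m \<and> f i m \<le> C) G"
proof -
  \<comment> \<open>The inserted values keep \<open>Min\<close> and \<open>Max\<close> meaningful
    for empty \<open>I\<close>, which occurs for the pairs when \<open>n = 1\<close>. Halving the
    minimum and adding 1 to the maximum place every limit strictly between \<open>c\<close> and
    \<open>C\<close>.\<close>
  define c where "c = Min (insert 1 (L ` I)) / 2"
  define C where "C = Max (insert 0 (L ` I)) + 1"
  have "Min (insert 1 (L ` I)) > 0"
    using assms(1,3) by (subst Min_gr_iff) auto
  then have "c > 0" by (simp add: c_def)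
  moreover have "eventually (\<lambda>m. c \<le> f i m \<and> f i m \<le> C) G" if i: "i \<in> I" for i
  proof -
    have "Min (insert 1 (L ` I)) \<le> L i" "L i \<le> Max (insert 0 (L ` I))"
      using assms(1) i by auto
    then have "c < L i" "L i < C"
      using \<open>c > 0\<close> by (auto simp: c_def C_def)
    then have "eventually (\<lambda>m. c < f i m) G" "eventually (\<lambda>m. f i m < C) G"
      using order_tendstoD[OF lim[OF i]] by blast+
    then show ?thesis by eventually_elim simp
  qed
  ultimately show thesis
    using that[of c C] assms(1) by (simp add: eventually_ball_finite)
qed

section \<open>Maximal self-stable sets\<close>

text \<open>Zorn's lemma applies because any two elements of the union of a chain already lie in a
  common member, where they are mutually stable.\<close>

lemma ex_maximal_self_stable:
  assumes "self_stable p r F0"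
  obtains F where "F0 \<subseteq> F" and "maximal_self_stable p r F"
proof -
  define A where "A = {F. self_stable p r F \<and> F0 \<subseteq> F}"
  have "\<exists>M\<in>A. \<forall>F\<in>A. M \<subseteq> F \<longrightarrow> F = M"
  proof (rule subset_Zorn_nonempty)
    show "A \<noteq> {}" using assms by (auto simp: A_def)
    fix \<C> assume "\<C> \<noteq> {}" and chain: "subset.chain A \<C>"
    have "mutually_stable r x y" if xy: "x \<in> \<Union>\<C>" "y \<in> \<Union>\<C>" for x y
    proof -
      obtain G H where GH: "G \<in> \<C>" "H \<in> \<C>" "x \<in> G" "y \<in> H" using xy by blast
      then have "G \<subseteq> H \<or> H \<subseteq> G" "G \<in> A" "H \<in> A"
        using chain unfolding subset_chain_def by blast+
      then show ?thesis using GH unfolding A_def self_stable_def by blast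
    qed
    moreover have "\<forall>G\<in>\<C>. G \<subseteq> Seq p r \<and> F0 \<subseteq> G"
      using chain unfolding subset_chain_def A_def self_stable_def by blast
    ultimately show "\<Union>\<C> \<in> A"
      using \<open>\<C> \<noteq> {}\<close> unfolding A_def self_stable_def by blast
  qed
  then obtain F where "F \<in> A" and max_A: "\<And>G. G \<in> A \<Longrightarrow> F \<subseteq> G \<Longrightarrow> G = F"
    by blast
  then have F: "self_stable p r F" "F0 \<subseteq> F"
    by (simp_all add: A_def)
  have max: "G = F" if "self_stable p r G" "F \<subseteq> G" for G
    using that F(2) max_A[of G] by (simp add: A_def)
  \<comment> \<open>Inclusion-maximality yields the condition of the definition: a sequence stable
    with all of \<open>F\<close> is also stable with itself, so it can be adjoined.\<close>
  have "y \<in> F" if y: "y \<in> Seq p r" "\<forall>x\<in>F. mutually_stable r x y" for y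
  proof -
    have "mutually_stable r y y" by (simp add: mutually_stable_def convergent_const)
    moreover have "\<forall>x\<in>F. mutually_stable r y x"
      using y(2) by (simp add: mutually_stable_def dist_commute)
    ultimately have "self_stable p r (insert y F)"
      using F(1) y by (auto simp: self_stable_def)
    from max[OF this] show "y \<in> F" by blast
  qed
  then have "maximal_self_stable p r F"
    using F(1) by (auto simp: maximal_self_stable_def)
  with F(2) show thesis by (rule that)
qed

lemma tendsto_scaled_dist:
  assumes "self_stable p r F" and "x \<in> F" and "y \<in> F"
  shows "(\<lambda>m. dist (x m) (y m) / r m) \<longlonglongrightarrow> scaled_dist r x y"
  using assms by (simp add: self_stable_def mutually_stable_def scaled_dist_def convergent_LIMSEQ_iff)

section \<open>Sequences tending to infinity slowly compared with \<open>r\<close>\<close>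

text \<open>Take \<open>z m\<close> to be the \<open>j\<close>-th of a sequence of points tending to infinity, where \<open>j \<le> m\<close> is the
  greatest index at which \<open>j\<close> times the distance from \<open>p\<close> is still at most \<open>r m\<close>.\<close>

lemma ex_slow_sequence:
  fixes p :: "'a::metric_space"
  assumes "\<not> bounded (UNIV :: 'a set)" and r: "scaling_sequence r"
  obtains z where "z \<in> Seq p r" and "(\<lambda>m. dist (z m) p / r m) \<longlonglongrightarrow> 0"
proof -
  have "\<exists>y. dist y p \<ge> real j" for j
  proof (rule ccontr)
    assume "\<nexists>y. dist y p \<ge> real j"
    then have "\<forall>y. dist p y \<le> real j" by (metis dist_commute nle_le)
    then show False using assms(1) by (auto simp: bounded_def)
  qed
  then obtain y where y: "\<And>j. dist (y j) p \<ge> real j" by metis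
  have r_pos: "r m > 0" for m using r by (simp add: scaling_sequence_def)
  \<comment> \<open>The bound \<open>j \<le> m\<close> makes \<open>J m\<close> finite, and 0 always
    belongs to it, so the maximum \<open>i m\<close> exists.\<close>
  define J where "J m = {j. j \<le> m \<and> real j * dist (y j) p \<le> r m}" for m
  define i where "i m = Max (J m)" for m
  have fin: "finite (J m)" for m by (simp add: J_def)
  have "0 \<in> J m" for m using r_pos[of m] by (simp add: J_def)
  then have "i m \<in> J m" for m unfolding i_def using Max_in[OF fin] by blast
  then have i: "real (i m) * dist (y (i m)) p \<le> r m" for m by (simp add: J_def)
  have i_inf: "filterlim i at_top sequentially"
    unfolding filterlim_at_top
  proof
    \<comment> \<open>Since \<open>r\<close> tends to infinity, each fixed \<open>j\<close>
      eventually lies in \<open>J m\<close> and is then at most \<open>i m\<close>.\<close>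
    fix j
    have "eventually (\<lambda>m. real j * dist (y j) p \<le> r m) sequentially"
      using r by (simp add: scaling_sequence_def filterlim_at_top)
    with eventually_ge_at_top[of j] show "eventually (\<lambda>m. j \<le> i m) sequentially"
    proof eventually_elim
      case (elim m)
      then have "j \<in> J m" by (simp add: J_def)
      then show ?case unfolding i_def using fin by (rule Max_ge[rotated])
    qed
  qed
  then have i_inf': "filterlim (\<lambda>m. real (i m)) at_top sequentially"
    by (rule filterlim_compose[OF filterlim_real_sequentially])
  then have inf: "filterlim (\<lambda>m. dist (y (i m)) p) at_top sequentially"
    by (rule filterlim_at_top_mono) (simp add: y)
  have null: "(\<lambda>m. dist (y (i m)) p / r m) \<longlonglongrightarrow> 0"
  proof (rule Lim_null_comparison)
    show "(\<lambda>m. 1 / real (i m)) \<longlonglongrightarrow> 0"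
      by (intro tendsto_divide_0[OF tendsto_const] filterlim_at_top_imp_at_infinity i_inf')
    \<comment> \<open>Once \<open>i m\<close> is positive, its membership in \<open>J m\<close>
      bounds the quotient by \<open>1 / i m\<close>.\<close>
    have "eventually (\<lambda>m. 1 \<le> i m) sequentially"
      using i_inf by (simp add: filterlim_at_top)
    then show "eventually (\<lambda>m. norm (dist (y (i m)) p / r m) \<le> 1 / real (i m)) sequentially"
    proof eventually_elim
      case (elim m)
      then show ?case using i[of m] r_pos[of m] by (simp add: field_simps)
    qed
  qed
  show thesis
    by (rule that[of "\<lambda>m. y (i m)"]) (use inf null in \<open>auto simp: Seq_def convergent_def\<close>)
qed

text \<open>Replacing \<open>p\<close> by \<open>z m\<close> changes a distance by at most
  \<open>dist (z m) p\<close>, which is negligible on the scale \<open>r\<close>. Thus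
  \<open>z\<close> stands in for the base point inside the pretangent space.\<close>

lemma tendsto_dist_slow_sequence:
  fixes p :: "'a::metric_space"
  assumes "\<And>m. r m > 0" and z: "(\<lambda>m. dist (z m) p / r m) \<longlonglongrightarrow> 0"
  shows "(\<lambda>m. dist (x m) (z m) / r m) \<longlonglongrightarrow> L \<longleftrightarrow> (\<lambda>m. dist (x m) p / r m) \<longlonglongrightarrow> L"
proof -
  have "(\<lambda>m. dist (x m) (z m) / r m - dist (x m) p / r m) \<longlonglongrightarrow> 0"
  proof (rule Lim_null_comparison[OF _ z], intro always_eventually allI)
    fix m
    have "\<bar>dist (x m) (z m) - dist (x m) p\<bar> \<le> dist (z m) p"
      using dist_triangle[of "x m" "z m" p] dist_triangle2[of "x m" p "z m"]
        dist_triangle[of "x m" p "z m"] by (simp add: dist_commute)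
    then show "norm (dist (x m) (z m) / r m - dist (x m) p / r m) \<le> dist (z m) p / r m"
      using assms(1)[of m] by (simp add: divide_right_mono flip: diff_divide_distrib)
  qed
  then show ?thesis by (rule Lim_transform_eq)
qed

text \<open>Being mutually stable with all of \<open>Seq p r\<close>, \<open>z\<close> cannot be
  left out of a maximal set. Its class is the point that raises \<open>n\<close> to
  \<open>n + 1\<close> in the counting below.\<close>

lemma slow_sequence_in_maximal:
  assumes "\<And>m. r m > 0" and "maximal_self_stable p r F"
    and z: "z \<in> Seq p r" "(\<lambda>m. dist (z m) p / r m) \<longlonglongrightarrow> 0"
  shows "z \<in> F"
proof -
  have "mutually_stable r x z" if "x \<in> F" for x
  proof -
    have "x \<in> Seq p r" using assms(2) that by (auto simp: maximal_self_stable_def self_stable_def)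
    then show ?thesis
      using tendsto_dist_slow_sequence[OF assms(1) z(2)]
      by (auto simp: Seq_def mutually_stable_def convergent_def)
  qed
  then show ?thesis using assms(2) z(1) by (auto simp: maximal_self_stable_def)
qed

section \<open>Points of pretangent spaces\<close>

text \<open>For \<open>x\<close> in \<open>F\<close> this is the point of the pretangent space
  represented by \<open>x\<close>.\<close>

definition pretangent_class ::
    "(nat \<Rightarrow> real) \<Rightarrow> (nat \<Rightarrow> 'a::metric_space) set \<Rightarrow> (nat \<Rightarrow> 'a) \<Rightarrow> (nat \<Rightarrow> 'a) set" where
  "pretangent_class r F x = {y \<in> F. scaled_dist r x y = 0}"

lemma pretangent_space_eq: "pretangent_space r F = pretangent_class r F ` F"
  by (auto simp: pretangent_space_def quotient_def pretangent_class_def)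

lemma scaled_dist_self: "scaled_dist r x x = 0"
  by (simp add: scaled_dist_def)

lemma in_pretangent_class: "x \<in> F \<Longrightarrow> x \<in> pretangent_class r F x"
  by (simp add: pretangent_class_def scaled_dist_self)

text \<open>The axiom that distinct points have nonzero distance, read off on
  representatives.\<close>

lemma pretangent_class_eq_iff:
  assumes "scaling_sequence r" and "self_stable p r F" and "x \<in> F" and "y \<in> F"
  shows "pretangent_class r F x = pretangent_class r F y \<longleftrightarrow> scaled_dist r x y = 0"
proof -
  have c: "pretangent_class r F x \<in> pretangent_space r F" "pretangent_class r F y \<in> pretangent_space r F"
    using assms by (auto simp: pretangent_space_eq)
  then show ?thesis
    using Metric_space.zero[OF Metric_space_pretangent(1)[OF assms(1,2)] c]
      Metric_space_pretangent(2)[OF assms(1,2) c in_pretangent_class in_pretangent_class] assms(3,4)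
    by simp
qed

section \<open>From more than \<open>n\<close> points to a positive lower bound for
  \<open>F_fun\<close>\<close>

lemma pretangent_space_large_imp_F_fun_not_null:
  fixes p :: "'a::metric_space"
  assumes unbounded: "\<not> bounded (UNIV :: 'a set)" and n: "n \<ge> 1"
    and r: "scaling_sequence r" and F: "maximal_self_stable p r F"
    and large: "\<not> (finite (pretangent_space r F) \<and> card (pretangent_space r F) \<le> n)"
  shows "\<not> (F_fun n p \<longlongrightarrow> 0) (tuples_to_infinity n p)"
proof
  assume null: "(F_fun n p \<longlongrightarrow> 0) (tuples_to_infinity n p)"
  have r_pos: "r m > 0" for m using r by (simp add: scaling_sequence_def)
  have stable: "self_stable p r F" using F by (simp add: maximal_self_stable_def)
  obtain z where z: "z \<in> Seq p r" "(\<lambda>m. dist (z m) p / r m) \<longlonglongrightarrow> 0"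
    using ex_slow_sequence[OF unbounded r] .
  have zF: "z \<in> F" using slow_sequence_in_maximal[OF r_pos F z] .
  \<comment> \<open>Deleting the class of \<open>z\<close>, which is one of the points, leaves at
    least \<open>n\<close>. The infinite case is separate because \<open>card\<close> is then
    0.\<close>
  obtain S where S: "S \<subseteq> pretangent_space r F - {pretangent_class r F z}" "card S = n" "finite S"
  proof (cases "finite (pretangent_space r F)")
    case True
    then have "n \<le> card (pretangent_space r F - {pretangent_class r F z})"
      using large zF by (simp add: pretangent_space_eq card_Diff_singleton)
    then show thesis using obtain_subset_with_card_n that by metis
  next
    case False
    then have "infinite (pretangent_space r F - {pretangent_class r F z})" by simp
    then show thesis using infinite_arbitrarily_large that by metis
  qed
  obtain g where g: "bij_betw g {1..n} S"
    using finite_same_card_bij[of "{1..n}" S] S by auto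
  have "\<exists>x. x \<in> F \<and> g k = pretangent_class r F x" if "k \<in> {1..n}" for k
    using bij_betwE[OF g] that S(1) unfolding pretangent_space_eq by blast
  then obtain x where x: "\<And>k. k \<in> {1..n} \<Longrightarrow> x k \<in> F \<and> g k = pretangent_class r F (x k)"
    by metis
  have nonneg: "scaled_dist r u v \<ge> 0" if "u \<in> F" "v \<in> F" for u v
    by (rule LIMSEQ_le_const[OF tendsto_scaled_dist[OF stable that]])
      (use r_pos in \<open>auto intro!: exI[of _ 0] simp: less_imp_le\<close>)
  have pos: "scaled_dist r u v > 0"
    if "u \<in> F" "v \<in> F" "pretangent_class r F u \<noteq> pretangent_class r F v" for u v
    using nonneg[OF that(1,2)] that pretangent_class_eq_iff[OF r stable that(1,2)] by simp
  \<comment> \<open>The limits of the distances from \<open>p\<close> are the distances to the class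
    of \<open>z\<close>, positive because that class was deleted.\<close>
  obtain c C where "c > 0"
    and base: "eventually (\<lambda>m. \<forall>k\<in>{1..n}. c \<le> dist (x k m) p / r m \<and> dist (x k m) p / r m \<le> C) sequentially"
  proof (rule finite_family_eventually_bounds)
    fix k assume k: "k \<in> {1..n}"
    then show "(\<lambda>m. dist (x k m) p / r m) \<longlonglongrightarrow> scaled_dist r (x k) z"
      using tendsto_scaled_dist[OF stable _ zF] x tendsto_dist_slow_sequence[OF r_pos z(2)] by blast
    have "g k \<noteq> pretangent_class r F z" using bij_betwE[OF g] k S(1) by blast
    then show "scaled_dist r (x k) z > 0" using x[OF k] zF pos by simp
  qed auto
  obtain c' C' where "c' > 0"
    and pair: "eventually (\<lambda>m. \<forall>e\<in>index_pairs n. c' \<le> dist (x (fst e) m) (x (snd e) m) / r m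
                 \<and> dist (x (fst e) m) (x (snd e) m) / r m \<le> C') sequentially"
  proof (rule finite_family_eventually_bounds)
    fix e assume "e \<in> index_pairs n"
    then have kl: "fst e \<in> {1..n}" "snd e \<in> {1..n}" "fst e \<noteq> snd e"
      by (auto simp: index_pairs_def)
    then show "(\<lambda>m. dist (x (fst e) m) (x (snd e) m) / r m) \<longlonglongrightarrow> scaled_dist r (x (fst e)) (x (snd e))"
      using tendsto_scaled_dist[OF stable] x by blast
    have "g (fst e) \<noteq> g (snd e)"
      using inj_onD[OF bij_betw_imp_inj_on[OF g]] kl by blast
    then show "scaled_dist r (x (fst e)) (x (snd e)) > 0"
      using x[OF kl(1)] x[OF kl(2)] pos by simp
  qed auto
  define c0 where "c0 = min c c'"
  define D where "D = (c0 / C) ^ Suc (card (index_pairs n))"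
  have "c0 > 0" using \<open>c > 0\<close> \<open>c' > 0\<close> by (simp add: c0_def)
  have below: "eventually (\<lambda>m. D \<le> F_fun n p (\<lambda>k. x k m)) sequentially"
    using base pair
  proof eventually_elim
    case (elim m)
    show ?case
      unfolding D_def
      by (rule F_fun_lower_bound[OF n r_pos[of m] \<open>c0 > 0\<close>]) (use elim in \<open>force simp: c0_def min_le_iff_disj\<close>)+
  qed
  \<comment> \<open>A single \<open>m\<close> at which both bounds hold gives
    \<open>c \<le> C\<close>, hence the positivity of \<open>C\<close> needed for
    \<open>D > 0\<close>.\<close>
  obtain m where "\<forall>k\<in>{1..n}. c \<le> dist (x k m) p / r m \<and> dist (x k m) p / r m \<le> C"
    using eventually_happens'[OF sequentially_bot base] by blast
  then have "c \<le> C" using n by (meson atLeastAtMost_iff order_refl order_trans)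
  then have "D > 0" using \<open>c0 > 0\<close> \<open>c > 0\<close> by (simp add: D_def)
  have "filterlim (\<lambda>m k. x k m) (tuples_to_infinity n p) sequentially"
    unfolding tuples_to_infinity_def filterlim_INF filterlim_filtercomap_iff o_def
    using x stable by (auto simp: self_stable_def Seq_def subset_iff)
  then have "(\<lambda>m. F_fun n p (\<lambda>k. x k m)) \<longlonglongrightarrow> 0"
    by (rule filterlim_compose[OF null])
  then have "D \<le> 0"
    by (rule tendsto_lowerbound[OF _ below]) simp
  with \<open>D > 0\<close> show False by simp
qed

section \<open>From tuples with large \<open>F_fun\<close> to a pretangent space with
  \<open>n + 1\<close> points\<close>

lemma F_fun_not_null_imp_pretangent_space_large:
  fixes p :: "'a::metric_space"
  assumes unbounded: "\<not> bounded (UNIV :: 'a set)" and n: "n \<ge> 1"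
    and not_null: "\<not> (F_fun n p \<longlongrightarrow> 0) (tuples_to_infinity n p)"
  shows "\<exists>r F. scaling_sequence r \<and> maximal_self_stable p r F
           \<and> \<not> (finite (pretangent_space r F) \<and> card (pretangent_space r F) \<le> n)"
proof -
  obtain \<epsilon> where "\<epsilon> > 0"
    and "\<not> eventually (\<lambda>x. dist (F_fun n p x) 0 < \<epsilon>) (tuples_to_infinity n p)"
    using not_null by (auto simp: tendsto_iff)
  \<comment> \<open>The bound \<open>m + 1\<close> makes the maximum \<open>R m\<close> positive
    already at \<open>m = 0\<close>.\<close>
  then have "\<exists>x. (\<forall>k\<in>{1..n}. dist (x k) p \<ge> real m + 1) \<and> \<epsilon> \<le> \<bar>F_fun n p x\<bar>" for m
    unfolding eventually_tuples_to_infinity by (auto simp: not_less)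
  then obtain t where t: "\<And>m k. k \<in> {1..n} \<Longrightarrow> dist (t m k) p \<ge> real m + 1"
    and F_ge: "\<And>m. \<epsilon> \<le> \<bar>F_fun n p (t m)\<bar>"
    by metis
  define R where "R m = (MAX k\<in>{1..n}. dist (t m k) p)" for m
  have le_R: "dist (t m k) p \<le> R m" if "k \<in> {1..n}" for m k
    unfolding R_def using that by (intro Max_ge) auto
  have R_ge: "real m + 1 \<le> R m" for m
    using t[of 1 m] le_R[of 1 m] n by simp
  have R_pos: "R m > 0" for m using R_ge[of m] by linarith
  have "0 \<le> F_fun n p (t m)" for m
    unfolding F_fun_normalized[OF n R_def[symmetric] R_pos] using R_pos[of m] n
    by (intro mult_nonneg_nonneg divide_nonneg_pos prod_nonneg) (auto simp: Min_ge_iff)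
  then have F_ge: "\<epsilon> \<le> F_fun n p (t m)" for m using F_ge[of m] by (simp add: abs_of_nonneg)
  \<comment> \<open>This is what remains of \<open>\<epsilon>\<close> after division by the constant
    of \<open>F_fun_upper_bounds\<close>; it bounds every normalized distance from below.\<close>
  define \<delta> where "\<delta> = \<epsilon> / 2 ^ card (index_pairs n)"
  have "\<delta> > 0" using \<open>\<epsilon> > 0\<close> by (simp add: \<delta>_def)
  have base_ge: "\<delta> \<le> dist (t m k) p / R m" if "k \<in> {1..n}" for m k
    using order_trans[OF F_ge F_fun_upper_bounds(1)[OF n R_def[symmetric] R_pos that]]
    by (simp add: \<delta>_def pos_divide_le_eq mult.commute)
  have pair_ge: "\<delta> \<le> dist (t m k) (t m l) / R m"
    if "k \<in> {1..n}" "l \<in> {1..n}" "k \<noteq> l" for m k l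
    using that
  proof (induction k l rule: linorder_wlog)
    case (le k l)
    then have "(k, l) \<in> index_pairs n" by (auto simp: index_pairs_def)
    from order_trans[OF F_ge F_fun_upper_bounds(2)[OF n R_def[symmetric] R_pos this]] show ?case
      by (simp add: \<delta>_def pos_divide_le_eq mult.commute)
  qed (simp add: dist_commute)
  \<comment> \<open>The distances from \<open>p\<close> converge along \<open>\<sigma>\<close>, the
    pair distances along a further subsequence \<open>\<tau>\<close> of it; the composition serves
    both.\<close>
  have "bounded (range (\<lambda>m. dist (t m k) p / R m))" if "k \<in> {1..n}" for k
    by (rule boundedI[of _ 1]) (use le_R[OF that] R_pos in \<open>auto simp: less_imp_le divide_le_eq_1\<close>)
  then obtain \<sigma> where \<sigma>: "strict_mono \<sigma>"
    "\<And>k. k \<in> {1..n} \<Longrightarrow> convergent ((\<lambda>m. dist (t m k) p / R m) \<circ> \<sigma>)"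
    using finite_family_convergent_subsequence[of "{1..n}" "\<lambda>k m. dist (t m k) p / R m"] by auto
  have "bounded (range ((\<lambda>m. dist (t m k) (t m l) / R m) \<circ> \<sigma>))"
    if "k \<in> {1..n}" "l \<in> {1..n}" for k l
  proof (rule boundedI[of _ 2])
    fix u assume "u \<in> range ((\<lambda>m. dist (t m k) (t m l) / R m) \<circ> \<sigma>)"
    then obtain m where u: "u = dist (t m k) (t m l) / R m" by auto
    have "dist (t m k) (t m l) \<le> 2 * R m"
      using dist_triangle2[of "t m k" "t m l" p] le_R[OF that(1)] le_R[OF that(2)]
      by (smt (verit))
    then show "norm u \<le> 2" using R_pos[of m] by (simp add: u field_simps)
  qed
  then obtain \<tau> where \<tau>: "strict_mono \<tau>"
    "\<And>k l. k \<in> {1..n} \<Longrightarrow> l \<in> {1..n} \<Longrightarrow> convergent ((\<lambda>m. dist (t m k) (t m l) / R m) \<circ> \<sigma> \<circ> \<tau>)"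
    using finite_family_convergent_subsequence[of "{1..n} \<times> {1..n}"
        "\<lambda>e. (\<lambda>m. dist (t m (fst e)) (t m (snd e)) / R m) \<circ> \<sigma>"] by auto
  define \<phi> where "\<phi> = \<sigma> \<circ> \<tau>"
  have \<phi>: "strict_mono \<phi>" unfolding \<phi>_def by (rule strict_mono_o[OF \<sigma>(1) \<tau>(1)])
  define r where "r m = R (\<phi> m)" for m
  define x where "x k m = t (\<phi> m) k" for k m
  have \<phi>_ge: "real m \<le> real (\<phi> m)" for m using seq_suble[OF \<phi>] by simp
  have r: "scaling_sequence r"
    unfolding scaling_sequence_def
  proof
    show "filterlim r at_top sequentially"
    proof (rule filterlim_at_top_mono[OF filterlim_real_sequentially], intro always_eventually allI)
      show "real m \<le> r m" for m using R_ge[of "\<phi> m"] \<phi>_ge[of m] by (simp add: r_def)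
    qed
  qed (simp add: r_def R_pos)
  have r_pos: "r m > 0" for m by (simp add: r_def R_pos)
  have "x k \<in> Seq p r" if k: "k \<in> {1..n}" for k
  proof -
    have "filterlim (\<lambda>m. dist (x k m) p) at_top sequentially"
    proof (rule filterlim_at_top_mono[OF filterlim_real_sequentially], intro always_eventually allI)
      show "real m \<le> dist (x k m) p" for m
        using t[OF k, of "\<phi> m"] \<phi>_ge[of m] by (simp add: x_def)
    qed
    moreover have "convergent (\<lambda>m. dist (x k m) p / r m)"
      using convergent_subseq_convergent[OF \<sigma>(2)[OF k] \<tau>(1)]
      by (simp add: o_def x_def r_def \<phi>_def)
    ultimately show ?thesis by (simp add: Seq_def)
  qed
  moreover have "mutually_stable r (x k) (x l)" if "k \<in> {1..n}" "l \<in> {1..n}" for k l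
    using \<tau>(2)[OF that] by (simp add: mutually_stable_def o_def x_def r_def \<phi>_def)
  ultimately have "self_stable p r (x ` {1..n})"
    by (auto simp: self_stable_def)
  then obtain F where sub: "x ` {1..n} \<subseteq> F" and F: "maximal_self_stable p r F"
    by (rule ex_maximal_self_stable)
  have stable: "self_stable p r F" using F by (simp add: maximal_self_stable_def)
  obtain z where z: "z \<in> Seq p r" "(\<lambda>m. dist (z m) p / r m) \<longlonglongrightarrow> 0"
    using ex_slow_sequence[OF unbounded r] .
  have zF: "z \<in> F" using slow_sequence_in_maximal[OF r_pos F z] .
  have xF: "x k \<in> F" if "k \<in> {1..n}" for k using that sub by blast
  \<comment> \<open>The bound \<open>\<delta>\<close> holds for every \<open>m\<close> and so passes
    to the limit, where \<open>z\<close> may replace \<open>p\<close>.\<close>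
  have to_z: "\<delta> \<le> scaled_dist r (x k) z" if k: "k \<in> {1..n}" for k
  proof (rule LIMSEQ_le_const)
    show "(\<lambda>m. dist (x k m) p / r m) \<longlonglongrightarrow> scaled_dist r (x k) z"
      using tendsto_scaled_dist[OF stable xF[OF k] zF]
      by (simp add: tendsto_dist_slow_sequence[OF r_pos z(2)])
  qed (simp add: x_def r_def base_ge[OF k])
  have between: "\<delta> \<le> scaled_dist r (x k) (x l)" if "k \<in> {1..n}" "l \<in> {1..n}" "k \<noteq> l" for k l
    by (rule LIMSEQ_le_const[OF tendsto_scaled_dist[OF stable xF[OF that(1)] xF[OF that(2)]]])
      (simp add: x_def r_def pair_ge[OF that])
  \<comment> \<open>Distances of at least \<open>\<delta>\<close> keep these \<open>n + 1\<close>
    classes distinct.\<close>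
  define S where "S = insert (pretangent_class r F z) ((\<lambda>k. pretangent_class r F (x k)) ` {1..n})"
  have "inj_on (\<lambda>k. pretangent_class r F (x k)) {1..n}"
  proof (rule inj_onI, rule ccontr)
    fix k l assume kl: "k \<in> {1..n}" "l \<in> {1..n}" "k \<noteq> l"
      "pretangent_class r F (x k) = pretangent_class r F (x l)"
    then show False
      using between[OF kl(1-3)] \<open>\<delta> > 0\<close> pretangent_class_eq_iff[OF r stable xF[OF kl(1)] xF[OF kl(2)]]
      by simp
  qed
  moreover have "pretangent_class r F z \<notin> (\<lambda>k. pretangent_class r F (x k)) ` {1..n}"
  proof
    assume "pretangent_class r F z \<in> (\<lambda>k. pretangent_class r F (x k)) ` {1..n}"
    then obtain k where k: "k \<in> {1..n}" "pretangent_class r F (x k) = pretangent_class r F z" by auto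
    then show False
      using to_z[OF k(1)] \<open>\<delta> > 0\<close> pretangent_class_eq_iff[OF r stable xF[OF k(1)] zF] by simp
  qed
  ultimately have "card S = Suc n" by (simp add: S_def card_image)
  moreover have "S \<subseteq> pretangent_space r F"
    using xF zF by (auto simp: S_def pretangent_space_eq)
  ultimately have "\<not> (finite (pretangent_space r F) \<and> card (pretangent_space r F) \<le> n)"
    by (metis card_mono not_less_eq_eq)
  with r F show ?thesis by blast
qed

theorem theorem4p3:
  fixes p :: "'a::metric_space" and n :: nat
  assumes "\<not> bounded (UNIV :: 'a set)" and "n \<ge> 2"
  shows "(\<forall>r F. scaling_sequence r \<and> maximal_self_stable p r F \<longrightarrow>
            finite (pretangent_space r F) \<and> card (pretangent_space r F) \<le> n)
         \<longleftrightarrow> (F_fun n p \<longlongrightarrow> 0) (tuples_to_infinity n p)"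
proof -
  have "n \<ge> 1" using assms(2) by simp
  \<comment> \<open>Each of the two lemmas is the contrapositive of one direction.\<close>
  with assms(1) show ?thesis
    using pretangent_space_large_imp_F_fun_not_null F_fun_not_null_imp_pretangent_space_large by blast
qed

end
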